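(* Let $(X,\mathcal{K})$ be any one of the three pairs $(\widetilde{S}^m,K_S(\mathbb{R}^m))$, $(S^m,K_S(\mathbb{R}^m))$, $(E^m,K_C(\mathbb{R}^m))$, and let $U$ be a subset of $X$. Then the following statements are equivalent. (i) $U$ is a totally bounded set in $(X,H_{\rm end})$. (ii) For each $\alpha\in(0,1]$, $U_\alpha:=\{[u]_\alpha:u\in U\}$ is a bounded set in $(\mathcal{K},H)$.
   Context: A fuzzy set on $\mathbb{R}^m$ is a function $u:\mathbb{R}^m\to[0,1]$. For $\alpha\in(0,1]$, $[u]_\alpha=\{x:u(x)\ge\alpha\}$, and $[u]_0=\overline{\{x:u(x)>0\}}$. Each of the following consists of upper semi-continuous fuzzy sets $u$ on $\mathbb{R}^m$ that are normal ($u(x_0)=1$ for some $x_0$), have $[u]_0$ bounded, and in addition: - $E^m$: $u(\lambda x+(1-\lambda)y)\ge\min\{u(x),u(y)\}$ for all $x,y\in\mathbb{R}^m$, $\lambda\in[0,1]$; - $S^m$: there exists $x\in\mathbb{R}^m$ such that $u(\lambda y+(1-\lambda)x)\ge u(y)$ for all $y\in\mathbb{R}^m$, $\lambda\in[0,1]$; - $\widetilde{S}^m$: for each $\lambda\in(0,1]$ there is $x_\lambda\in[u]_\lambda$ such that the line segment $\overline{x_\lambda y}$ is contained in $[u]_\lambda$ for all $y\in[u]_\lambda$. $K_C(\mathbb{R}^m)$ and $K_S(\mathbb{R}^m)$ are the sets of all nonempty compact convex, and nonempty compact star-shaped, subsets of $\mathbb{R}^m$ respectively ($K$ is star-shaped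 if there is $x\in K$ with $\overline{xy}\subset K$ for every $y\in K$). $H(A,B)=\max\{\sup_{a\in A}\inf_{b\in B}d(a,b),\ \sup_{b\in B}\inf_{a\in A}d(a,b)\}$ is the Hausdorff metric on nonempty closed sets ($d$ Euclidean). The endograph of $u$ is ${\rm end}\,u=\{(x,t)\in\mathbb{R}^m\times[0,1]:u(x)\ge t\}$ and $H_{\rm end}(u,v)=H({\rm end}\,u,{\rm end}\,v)$. *)

theory Defs
  imports "HOL-Analysis.Analysis"
begin

section \<open>The Hausdorff metric\<close>

text \<open>The suprema and infima are taken in \<open>[0, \<infinity>]\<close>, so that they exist for all sets, and the result is
  then read as a real number.  An infinite distance would become 0, but it does not occur between
  nonempty compact sets, nor between endographs of fuzzy sets; see
  \<open>Metric_space_compact_hausdist\<close> and \<open>Metric_space_H_end\<close>.\<close>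

definition hausdist_enn :: "'a::metric_space set \<Rightarrow> 'a set \<Rightarrow> ennreal" where
  "hausdist_enn A B =
     max (SUP a\<in>A. INF b\<in>B. ennreal (dist a b)) (SUP b\<in>B. INF a\<in>A. ennreal (dist a b))"

definition hausdist :: "'a::metric_space set \<Rightarrow> 'a set \<Rightarrow> real" where
  "hausdist A B = enn2real (hausdist_enn A B)"

definition compact_convex_sets :: "(real ^ 'm) set set" where
  "compact_convex_sets = {K. K \<noteq> {} \<and> compact K \<and> convex K}"

definition compact_starlike_sets :: "(real ^ 'm) set set" where
  "compact_starlike_sets = {K. K \<noteq> {} \<and> compact K \<and> starlike K}"

section \<open>Fuzzy sets\<close>

definition alpha_cut :: "(real ^ 'm \<Rightarrow> real) \<Rightarrow> real \<Rightarrow> (real ^ 'm) set" where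
  "alpha_cut u \<alpha> = (if \<alpha> = 0 then closure {x. u x > 0} else {x. u x \<ge> \<alpha>})"

definition upper_semicontinuous :: "('a::topological_space \<Rightarrow> real) \<Rightarrow> bool" where
  "upper_semicontinuous u \<longleftrightarrow> (\<forall>x c. u x < c \<longrightarrow> (\<forall>\<^sub>F y in nhds x. u y < c))"

text \<open>The conditions common to the three classes of fuzzy sets.\<close>

definition usc_fuzzy_sets :: "(real ^ 'm \<Rightarrow> real) set" where
  "usc_fuzzy_sets =
     {u. range u \<subseteq> {0..1} \<and> upper_semicontinuous u \<and> (\<exists>x. u x = 1) \<and> bounded (alpha_cut u 0)}"

definition fuzzy_E :: "(real ^ 'm \<Rightarrow> real) set" where
  "fuzzy_E = {u \<in> usc_fuzzy_sets.
     \<forall>x y. \<forall>l\<in>{0..1}. u (l *\<^sub>R x + (1 - l) *\<^sub>R y) \<ge> min (u x) (u y)}"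

definition fuzzy_S :: "(real ^ 'm \<Rightarrow> real) set" where
  "fuzzy_S = {u \<in> usc_fuzzy_sets.
     \<exists>x. \<forall>y. \<forall>l\<in>{0..1}. u (l *\<^sub>R y + (1 - l) *\<^sub>R x) \<ge> u y}"

definition fuzzy_S_tilde :: "(real ^ 'm \<Rightarrow> real) set" where
  "fuzzy_S_tilde = {u \<in> usc_fuzzy_sets. \<forall>l\<in>{0<..1}. starlike (alpha_cut u l)}"

definition endograph :: "(real ^ 'm \<Rightarrow> real) \<Rightarrow> ((real ^ 'm) \<times> real) set" where
  "endograph u = {(x, t). t \<in> {0..1} \<and> u x \<ge> t}"

text \<open>The distance on the product type is the Euclidean one.\<close>

definition H_end :: "(real ^ 'm \<Rightarrow> real) \<Rightarrow> (real ^ 'm \<Rightarrow> real) \<Rightarrow> real" where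
  "H_end u v = hausdist (endograph u) (endograph v)"

section \<open>The metric space axioms\<close>

lemma hausdist_nonneg: "0 \<le> hausdist A B"
  by (simp add: hausdist_def)

lemma hausdist_commute: "hausdist A B = hausdist B A"
  by (simp add: hausdist_def hausdist_enn_def max.commute dist_commute)

lemma INF_ennreal_add_const_on:
  fixes f :: "'i \<Rightarrow> ennreal"
  assumes "I \<noteq> {}"
  shows "(INF i\<in>I. f i + c) = (INF i\<in>I. f i) + c"
  using continuous_at_Inf_mono[of "\<lambda>x. x + c" "f ` I"] assms
    continuous_add[of "at_right (Inf (f ` I))", of "\<lambda>x. x" "\<lambda>x. c"]
  by (auto simp: mono_def image_comp)

lemma semi_hausdist_triangle:
  fixes A B C :: "'a::metric_space set"
  assumes "B \<noteq> {}"
  shows "(SUP a\<in>A. INF c\<in>C. ennreal (dist a c)) \<le>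
    (SUP a\<in>A. INF b\<in>B. ennreal (dist a b)) + (SUP b\<in>B. INF c\<in>C. ennreal (dist b c))"
    (is "_ \<le> ?AB + ?BC")
proof (rule SUP_least)
  fix a assume a: "a \<in> A"
  have "(INF c\<in>C. ennreal (dist a c)) \<le> ennreal (dist a b) + ?BC" if b: "b \<in> B" for b
  proof -
    have "(INF c\<in>C. ennreal (dist a c)) \<le> (INF c\<in>C. ennreal (dist a b) + ennreal (dist b c))"
      by (intro INF_mono) (metis dist_triangle ennreal_leI ennreal_plus zero_le_dist)
    also have "\<dots> = ennreal (dist a b) + (INF c\<in>C. ennreal (dist b c))"
    proof (cases "C = {}")
      case False
      then show ?thesis
        using INF_ennreal_add_const_on[of C "\<lambda>c. ennreal (dist b c)" "ennreal (dist a b)"]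
        by (simp add: add.commute)
    qed auto
    also have "\<dots> \<le> ennreal (dist a b) + ?BC"
      using b by (intro add_left_mono SUP_upper)
    finally show ?thesis .
  qed
  then have "(INF c\<in>C. ennreal (dist a c)) \<le> (INF b\<in>B. ennreal (dist a b) + ?BC)"
    by (rule INF_greatest)
  also have "\<dots> = (INF b\<in>B. ennreal (dist a b)) + ?BC"
    using assms by (subst INF_ennreal_add_const_on) auto
  also have "\<dots> \<le> ?AB + ?BC"
    using a by (intro add_right_mono SUP_upper)
  finally show "(INF c\<in>C. ennreal (dist a c)) \<le> ?AB + ?BC" .
qed

lemma hausdist_enn_triangle:
  assumes "B \<noteq> {}"
  shows "hausdist_enn A C \<le> hausdist_enn A B + hausdist_enn B C"
proof -
  have "(SUP a\<in>A. INF c\<in>C. ennreal (dist a c)) \<le> hausdist_enn A B + hausdist_enn B C"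
    by (rule order_trans[OF semi_hausdist_triangle[OF assms]])
       (auto simp: hausdist_enn_def intro!: add_mono)
  moreover have "(SUP c\<in>C. INF a\<in>A. ennreal (dist c a)) \<le> hausdist_enn B C + hausdist_enn A B"
    by (rule order_trans[OF semi_hausdist_triangle[OF assms]])
       (auto simp: hausdist_enn_def dist_commute intro!: add_mono)
  ultimately show ?thesis
    unfolding hausdist_enn_def[of A C] by (simp add: dist_commute add.commute)
qed

lemma semi_hausdist_zero:
  fixes A B :: "'a::metric_space set"
  assumes "(SUP a\<in>A. INF b\<in>B. ennreal (dist a b)) = 0" "closed B"
  shows "A \<subseteq> B"
proof
  fix a assume a: "a \<in> A"
  have "(INF b\<in>B. ennreal (dist a b)) \<le> (SUP a\<in>A. INF b\<in>B. ennreal (dist a b))"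
    using a by (rule SUP_upper)
  then have z: "(INF b\<in>B. ennreal (dist a b)) = 0" using assms by simp
  have "\<exists>b\<in>B. dist b a < e" if "e > 0" for e
  proof -
    have "(INF b\<in>B. ennreal (dist a b)) < ennreal e" using z that by simp
    then obtain b where "b \<in> B" "ennreal (dist a b) < ennreal e" by (auto simp: INF_less_iff)
    then show ?thesis by (auto simp: dist_commute ennreal_less_iff)
  qed
  then have "a \<in> closure B" by (auto simp: closure_approachable)
  then show "a \<in> B" using assms by simp
qed

lemma Metric_space_hausdist:
  fixes \<C> :: "'a::metric_space set set"
  assumes ne: "\<And>A. A \<in> \<C> \<Longrightarrow> A \<noteq> {} \<and> closed A"
    and fin: "\<And>A B. A \<in> \<C> \<Longrightarrow> B \<in> \<C> \<Longrightarrow> hausdist_enn A B < \<infinity>"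
  shows "Metric_space \<C> hausdist"
proof
  fix A B C :: "'a set"
  show "0 \<le> hausdist A B" by (rule hausdist_nonneg)
  show "hausdist A B = hausdist B A" by (rule hausdist_commute)
  show "hausdist A B = 0 \<longleftrightarrow> A = B" if A: "A \<in> \<C>" and B: "B \<in> \<C>"
  proof
    assume "hausdist A B = 0"
    then have "hausdist_enn A B = 0"
      using fin[OF A B] by (auto simp: hausdist_def enn2real_eq_0_iff)
    then have *: "(SUP a\<in>A. INF b\<in>B. ennreal (dist a b)) = 0"
        "(SUP b\<in>B. INF a\<in>A. ennreal (dist b a)) = 0"
      unfolding hausdist_enn_def
      by (metis max.cobounded1 le_zero_eq, metis (no_types, lifting) INF_cong SUP_cong dist_commute max.cobounded2 le_zero_eq)
    show "A = B"
      using semi_hausdist_zero[OF *(1)] semi_hausdist_zero[OF *(2)] ne A B by blast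
  next
    assume "A = B"
    have "(INF b\<in>A. ennreal (dist a b)) = 0" "(INF b\<in>A. ennreal (dist b a)) = 0"
      if "a \<in> A" for a
      using INF_lower[OF that, of "\<lambda>b. ennreal (dist a b)"]
        INF_lower[OF that, of "\<lambda>b. ennreal (dist b a)"] by auto
    then show "hausdist A B = 0"
      using \<open>A = B\<close> ne[OF A] by (simp add: hausdist_def hausdist_enn_def)
  qed
  show "hausdist A C \<le> hausdist A B + hausdist B C"
    if A: "A \<in> \<C>" and B: "B \<in> \<C>" and C: "C \<in> \<C>"
  proof -
    have "enn2real (hausdist_enn A C) \<le> enn2real (hausdist_enn A B + hausdist_enn B C)"
      using hausdist_enn_triangle[of B A C] ne[OF B] fin[OF A B] fin[OF B C]
      by (intro enn2real_mono) auto
    then show ?thesis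
      using fin[OF A B] fin[OF B C] by (simp add: hausdist_def enn2real_plus)
  qed
qed

lemma hausdist_enn_finiteI:
  assumes "\<And>a. a \<in> A \<Longrightarrow> \<exists>b\<in>B. dist a b \<le> r" "\<And>b. b \<in> B \<Longrightarrow> \<exists>a\<in>A. dist a b \<le> r"
  shows "hausdist_enn A B < \<infinity>"
proof -
  have "hausdist_enn A B \<le> ennreal r"
    unfolding hausdist_enn_def
    by (intro max.boundedI SUP_least)
       (meson INF_lower2 assms ennreal_leI)+
  also have "\<dots> < \<infinity>" by simp
  finally show ?thesis .
qed

lemma Metric_space_compact_hausdist:
  fixes \<C> :: "'a::metric_space set set"
  assumes "\<And>A. A \<in> \<C> \<Longrightarrow> A \<noteq> {} \<and> compact A"
  shows "Metric_space \<C> hausdist"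
proof (rule Metric_space_hausdist)
  show "A \<noteq> {} \<and> closed A" if "A \<in> \<C>" for A
    using assms[OF that] compact_imp_closed by blast
next
  fix A B assume A: "A \<in> \<C>" and B: "B \<in> \<C>"
  then have "bounded (A \<union> B)" using assms compact_imp_bounded by auto
  then obtain r where "\<forall>a\<in>A\<union>B. \<forall>b\<in>A\<union>B. dist a b \<le> r"
    using bounded_two_points by metis
  then show "hausdist_enn A B < \<infinity>"
    by (intro hausdist_enn_finiteI[where r = r]) (use assms A B in blast)+
qed

lemma Metric_space_compact_convex_sets: "Metric_space compact_convex_sets hausdist"
  by (rule Metric_space_compact_hausdist) (simp add: compact_convex_sets_def)

lemma Metric_space_compact_starlike_sets: "Metric_space compact_starlike_sets hausdist"
  by (rule Metric_space_compact_hausdist) (simp add: compact_starlike_sets_def)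

lemma closed_endograph:
  assumes "upper_semicontinuous u"
  shows "closed (endograph u)"
proof -
  have "open (- {(x, t). u x \<ge> t})"
  proof (rule Topological_Spaces.openI)
    fix p assume "p \<in> - {(x, t). u x \<ge> t}"
    then obtain x t where p: "p = (x, t)" "u x < t" by (cases p) auto
    then obtain c where c: "u x < c" "c < t" using dense by blast
    then obtain S where S: "open S" "x \<in> S" "\<forall>y\<in>S. u y < c"
      using assms unfolding upper_semicontinuous_def eventually_nhds by metis
    have "open (S \<times> {c<..})" using S by (intro open_Times) auto
    moreover have "p \<in> S \<times> {c<..}" using p c S by auto
    moreover have "S \<times> {c<..} \<subseteq> - {(x, t). u x \<ge> t}" using S by fastforce
    ultimately show "\<exists>T. open T \<and> p \<in> T \<and> T \<subseteq> - {(x, t). u x \<ge> t}" by blast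
  qed
  then have "closed ({(x, t). u x \<ge> t} \<inter> UNIV \<times> {0..1})"
    by (intro closed_Int closed_Times) (auto simp: closed_def)
  moreover have "{(x, t). u x \<ge> t} \<inter> UNIV \<times> {0..1} = endograph u"
    by (auto simp: endograph_def)
  ultimately show ?thesis by simp
qed

lemma endograph_inject:
  assumes "range u \<subseteq> {0..1}" "range v \<subseteq> {0..1}" "endograph u = endograph v"
  shows "u = v"
proof
  fix x
  have uv: "u x \<in> {0..1}" "v x \<in> {0..1}" using assms(1,2) by blast+
  then have "(x, u x) \<in> endograph v" "(x, v x) \<in> endograph u"
    using assms(3) by (auto simp: endograph_def)
  then show "u x = v x" by (auto simp: endograph_def)
qed

lemma endograph_base:
  assumes "range u \<subseteq> {0..1}"
  shows "(x, 0) \<in> endograph u"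
proof -
  have "u x \<in> {0..1}" using assms by blast
  then show ?thesis by (simp add: endograph_def)
qed

lemma Metric_space_H_end:
  fixes X :: "(real ^ 'm \<Rightarrow> real) set"
  assumes "X \<subseteq> usc_fuzzy_sets"
  shows "Metric_space X H_end"
proof -
  have rg: "range u \<subseteq> {0..1}" and usc: "upper_semicontinuous u" if "u \<in> X" for u
    using assms that by (auto simp: usc_fuzzy_sets_def)
  have near: "\<exists>b\<in>endograph v. dist a b \<le> 1 \<and> dist b a \<le> 1"
    if "a \<in> endograph u" "v \<in> X" for u v :: "real ^ 'm \<Rightarrow> real" and a
  proof (rule bexI[of _ "(fst a, 0)"])
    show "(fst a, 0) \<in> endograph v" using endograph_base rg that by blast
    show "dist a (fst a, 0) \<le> 1 \<and> dist (fst a, 0) a \<le> 1"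
      using that(1) by (auto simp: endograph_def dist_Pair_Pair)
  qed
  interpret E: Metric_space "endograph ` X" hausdist
  proof (rule Metric_space_hausdist)
    show "A \<noteq> {} \<and> closed A" if "A \<in> endograph ` X" for A
      using that closed_endograph usc endograph_base rg by blast
    show "hausdist_enn A B < \<infinity>" if "A \<in> endograph ` X" "B \<in> endograph ` X" for A B
      using that near by (intro hausdist_enn_finiteI[where r = 1]) blast+
  qed
  show ?thesis
  proof
    fix u v w :: "real ^ 'm \<Rightarrow> real"
    show "0 \<le> H_end u v" by (simp add: H_end_def)
    show "H_end u v = H_end v u" by (simp add: H_end_def E.commute)
    show "H_end u v = 0 \<longleftrightarrow> u = v" if "u \<in> X" "v \<in> X"
      using that endograph_inject[OF rg rg] by (auto simp: H_end_def)
    show "H_end u w \<le> H_end u v + H_end v w" if "u \<in> X" "v \<in> X" "w \<in> X"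
      using that E.triangle by (simp add: H_end_def)
  qed
qed

end

theory Submission
  imports Defs
begin

text \<open>
  Both conditions say the same thing about the points of space: for every level \<open>\<alpha> > 0\<close>, the cuts
  \<open>[u]\<^sub>\<alpha>\<close> with \<open>u \<in> U\<close> lie in a common ball.

  For a family of nonempty compact sets, Hausdorff boundedness means that its union is bounded
  (lemma \<open>mbounded_hausdist_iff\<close>).  The shape conditions on \<open>X\<close> place the cuts in \<open>\<K>\<close>
  (lemma \<open>alpha_cut_in_shape_class\<close>).

  The core is \<open>mtotally_bounded_H_end_iff\<close>.  If \<open>U\<close> is totally bounded, finitely many of its members
  approximate all others up to an error below \<open>\<alpha>\<close>.  A point of \<open>[u]\<^sub>\<alpha>\<close> gives a point of height \<open>\<alpha>\<close>
  in the endograph of \<open>u\<close>, so a point of positive height in the endograph of one of these finitely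
  many members is near; and the supports of those are bounded.

  Conversely, fix \<open>\<epsilon>\<close> and a ball containing all cuts of level \<open>\<epsilon>\<close>.  The part of an endograph below
  height \<open>\<epsilon>\<close> is within \<open>\<epsilon>\<close> of the base \<open>\<real>\<^sup>m \<times> {0}\<close>, which every endograph contains; the part above
  lies in a fixed compact cylinder.  With a finite \<open>\<epsilon>\<close>-net of the cylinder, an endograph is known up
  to \<open>2\<epsilon>\<close> once it is known which net points are \<open>\<epsilon>\<close>-close to it, and this leaves finitely many
  possibilities.
\<close>

section \<open>The Hausdorff distance in terms of points\<close>

lemma hausdist_leI:
  assumes "0 \<le> r" "\<And>a. a \<in> A \<Longrightarrow> \<exists>b\<in>B. dist a b \<le> r" "\<And>b. b \<in> B \<Longrightarrow> \<exists>a\<in>A. dist a b \<le> r"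
  shows "hausdist A B \<le> r"
proof -
  have "hausdist_enn A B \<le> ennreal r"
    unfolding hausdist_enn_def
    by (intro max.boundedI SUP_least)
       (meson INF_lower2 assms ennreal_leI)+
  then show ?thesis
    unfolding hausdist_def using assms(1) by (rule enn2real_leI[rotated])
qed

text \<open>Finiteness is essential: an infinite distance is read as 0 and would not bound anything.\<close>

lemma hausdist_lessD:
  assumes "hausdist_enn A B < \<infinity>" "hausdist A B < r" "a \<in> A"
  shows "\<exists>b\<in>B. dist a b < r"
proof -
  have "(INF b\<in>B. ennreal (dist a b)) \<le> hausdist_enn A B"
    unfolding hausdist_enn_def using assms(3) by (intro max.coboundedI1 SUP_upper)
  also have "\<dots> = ennreal (hausdist A B)"
    using assms(1) by (simp add: hausdist_def)
  also have "\<dots> < ennreal r"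
    using assms(2) hausdist_nonneg[of A B] by (simp add: ennreal_less_iff)
  finally show ?thesis
    by (auto simp: INF_less_iff ennreal_less_iff)
qed

lemma mbounded_hausdist_iff:
  fixes \<C> S :: "'a::metric_space set set"
  assumes \<C>: "\<And>A. A \<in> \<C> \<Longrightarrow> A \<noteq> {} \<and> compact A" and "S \<subseteq> \<C>"
  shows "Metric_space.mbounded \<C> hausdist S \<longleftrightarrow> bounded (\<Union>S)"
proof -
  interpret Metric_space \<C> hausdist
    by (rule Metric_space_compact_hausdist[OF \<C>])
  show ?thesis
  proof
    assume "mbounded S"
    then obtain A r where S: "S \<subseteq> mcball A r" unfolding mbounded_def by blast
    show "bounded (\<Union>S)"
    proof (cases "S = {}")
      case False
      then have A: "A \<in> \<C>" using S by auto
      then obtain x q where q: "\<And>a. a \<in> A \<Longrightarrow> dist x a \<le> q"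
        using \<C> compact_imp_bounded unfolding bounded_def by metis
      have "dist x b \<le> q + (r + 1)" if B': "B \<in> S" "b \<in> B" for b B
      proof -
        have B: "B \<in> \<C>" "hausdist B A \<le> r" using S B' commute by auto
        then have "bounded (A \<union> B)" using \<C> A compact_imp_bounded by auto
        then obtain d where "\<forall>a\<in>A\<union>B. \<forall>b\<in>A\<union>B. dist a b \<le> d"
          using bounded_two_points by metis
        then have "hausdist_enn B A < \<infinity>"
          by (intro hausdist_enn_finiteI[where r = d]) (use \<C> A B in blast)+
        then obtain a where "a \<in> A" "dist b a < r + 1"
          using hausdist_lessD[of B A "r + 1" b] B(2) B'(2) by force
        then show ?thesis using q[of a] dist_triangle[of x b a] by (simp add: dist_commute)
      qed
      then show ?thesis unfolding bounded_def by blast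
    qed simp
  next
    assume bdd: "bounded (\<Union>S)"
    show "mbounded S"
    proof (cases "S = {}")
      case False
      then obtain A where A: "A \<in> S" by blast
      obtain r where r: "\<forall>a\<in>\<Union>S. \<forall>b\<in>\<Union>S. dist a b \<le> r"
        using bdd bounded_two_points by metis
      have "hausdist A B \<le> r" if B: "B \<in> S" for B
      proof -
        obtain a b where ab: "a \<in> A" "b \<in> B" using \<C> assms(2) A B by blast
        then have "dist a b \<le> r" using r A B by blast
        then have "0 \<le> r" using zero_le_dist[of a b] by linarith
        then show ?thesis
          using r A B ab by (intro hausdist_leI) blast+
      qed
      then have "S \<subseteq> mcball A r" using A assms(2) by auto
      then show ?thesis unfolding mbounded_def by blast
    qed simp
  qed
qed

section \<open>Endographs and cuts\<close>

lemma H_end_lessD: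
  assumes "range u \<subseteq> {0..1}" "range v \<subseteq> {0..1}" "H_end u v < r" "p \<in> endograph u"
  shows "\<exists>q\<in>endograph v. dist p q < r"
proof (rule hausdist_lessD)
  \<comment> \<open>Dropping a point of one endograph to height 0 moves it by at most 1 into the other one.\<close>
  have near: "(fst a, 0) \<in> endograph w \<and> dist a (fst a, 0) \<le> 1 \<and> dist (fst a, 0) a \<le> 1"
    if "a \<in> endograph w'" "range w \<subseteq> {0..1}" for w w' :: "real ^ 'a \<Rightarrow> real" and a
    using that endograph_base by (auto simp: endograph_def dist_Pair_Pair)
  show "hausdist_enn (endograph u) (endograph v) < \<infinity>"
    using near assms(1,2) by (intro hausdist_enn_finiteI[where r = 1]) blast+
qed (use assms in \<open>simp_all add: H_end_def\<close>)

lemma H_end_leI: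
  assumes "0 \<le> r"
    and "\<And>p. p \<in> endograph u \<Longrightarrow> \<exists>q\<in>endograph v. dist p q \<le> r"
    and "\<And>p. p \<in> endograph v \<Longrightarrow> \<exists>q\<in>endograph u. dist p q \<le> r"
  shows "H_end u v \<le> r"
  unfolding H_end_def using assms by (intro hausdist_leI) (auto simp: dist_commute)

lemma usc_fuzzy_sets_range: "u \<in> usc_fuzzy_sets \<Longrightarrow> range u \<subseteq> {0..1}"
  by (simp add: usc_fuzzy_sets_def)

lemma compact_alpha_cut:
  assumes "u \<in> usc_fuzzy_sets" "\<alpha> \<in> {0<..1}"
  shows "alpha_cut u \<alpha> \<noteq> {} \<and> compact (alpha_cut u \<alpha>)"
proof -
  obtain x where "u x = 1" using assms(1) by (auto simp: usc_fuzzy_sets_def)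
  then have ne: "x \<in> alpha_cut u \<alpha>" using assms(2) by (auto simp: alpha_cut_def)
  \<comment> \<open>A cut is a preimage of a horizontal slice of the endograph.\<close>
  have "alpha_cut u \<alpha> = (\<lambda>x. (x, \<alpha>)) -` endograph u"
    using assms(2) by (auto simp: alpha_cut_def endograph_def)
  moreover have "closed (endograph u)"
    using assms(1) closed_endograph by (auto simp: usc_fuzzy_sets_def)
  ultimately have "closed (alpha_cut u \<alpha>)"
    by (auto intro!: continuous_closed_vimage continuous_intros)
  moreover have "alpha_cut u \<alpha> \<subseteq> alpha_cut u 0"
    using assms(2) closure_subset[of "{x. u x > 0}"] by (auto simp: alpha_cut_def)
  then have "bounded (alpha_cut u \<alpha>)"
    using assms(1) bounded_subset by (auto simp: usc_fuzzy_sets_def)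
  ultimately show ?thesis using ne compact_eq_bounded_closed by blast
qed

lemma alpha_cut_in_shape_class:
  fixes X :: "(real ^ 'm \<Rightarrow> real) set" and \<K> :: "(real ^ 'm) set set"
  assumes "(X, \<K>) \<in> {(fuzzy_S_tilde, compact_starlike_sets),
                      (fuzzy_S, compact_starlike_sets),
                      (fuzzy_E, compact_convex_sets)}"
    and u: "u \<in> X" and \<alpha>: "\<alpha> \<in> {0<..1}"
  shows "alpha_cut u \<alpha> \<in> \<K>"
proof -
  have "u \<in> usc_fuzzy_sets"
    using assms(1) u by (auto simp: fuzzy_S_tilde_def fuzzy_S_def fuzzy_E_def)
  note cut = compact_alpha_cut[OF this \<alpha>]
  consider (tilde) "X = fuzzy_S_tilde" "\<K> = compact_starlike_sets"
    | (S) "X = fuzzy_S" "\<K> = compact_starlike_sets"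
    | (E) "X = fuzzy_E" "\<K> = compact_convex_sets"
    using assms(1) by blast
  then show ?thesis
  proof cases
    case tilde
    then show ?thesis
      using cut u \<alpha> by (auto simp: compact_starlike_sets_def fuzzy_S_tilde_def)
  next
    case S
    then obtain x where x: "\<And>y l. l \<in> {0..1} \<Longrightarrow> u (l *\<^sub>R y + (1 - l) *\<^sub>R x) \<ge> u y"
      using u unfolding fuzzy_S_def by blast
    obtain z where z: "z \<in> alpha_cut u \<alpha>" using cut by blast
    \<comment> \<open>With \<open>l = 0\<close>, the centre \<open>x\<close> maximises \<open>u\<close>, so it belongs to every cut.\<close>
    have "x \<in> alpha_cut u \<alpha>"
      using x[of 0 z] z \<alpha> by (auto simp: alpha_cut_def)
    moreover have "closed_segment x y \<subseteq> alpha_cut u \<alpha>" if y: "y \<in> alpha_cut u \<alpha>" for y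
    proof
      fix w assume "w \<in> closed_segment x y"
      then obtain l where l: "l \<in> {0..1}" "w = l *\<^sub>R y + (1 - l) *\<^sub>R x"
        by (auto simp: closed_segment_def add.commute)
      then show "w \<in> alpha_cut u \<alpha>"
        using x[of l y] y \<alpha> by (auto simp: alpha_cut_def)
    qed
    ultimately have "starlike (alpha_cut u \<alpha>)" unfolding starlike_def by blast
    then show ?thesis using cut S by (simp add: compact_starlike_sets_def)
  next
    case E
    then have uE: "\<And>x y l. l \<in> {0..1} \<Longrightarrow> u (l *\<^sub>R x + (1 - l) *\<^sub>R y) \<ge> min (u x) (u y)"
      using u by (auto simp: fuzzy_E_def)
    have "convex (alpha_cut u \<alpha>)"
    proof (rule convexI)
      fix x y :: "real ^ 'm" and a b :: real
      assume xy: "x \<in> alpha_cut u \<alpha>" "y \<in> alpha_cut u \<alpha>" and ab: "0 \<le> a" "0 \<le> b" "a + b = 1"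
      then have b: "b = 1 - a" by simp
      then show "a *\<^sub>R x + b *\<^sub>R y \<in> alpha_cut u \<alpha>"
        unfolding b using uE[of a x y] xy ab \<alpha>
          by (auto simp: alpha_cut_def min_def split: if_splits)
    qed
    then show ?thesis using cut E by (simp add: compact_convex_sets_def)
  qed
qed

section \<open>Total boundedness in the endograph metric\<close>

text \<open>Since \<open>H_end u v < \<alpha>\<close>, the endograph point near \<open>(x, \<alpha>)\<close> has positive height, so its base
  point lies in the support of \<open>v\<close>.\<close>

lemma alpha_cut_near_support:
  assumes "range u \<subseteq> {0..1}" "range v \<subseteq> {0..1}" "H_end u v < \<alpha>" "\<alpha> \<in> {0<..1}"
    and "x \<in> alpha_cut u \<alpha>"
  shows "\<exists>y\<in>alpha_cut v 0. dist x y < \<alpha>"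
proof -
  have "(x, \<alpha>) \<in> endograph u"
    using assms(4,5) by (auto simp: endograph_def alpha_cut_def)
  then obtain y s where ys: "(y, s) \<in> endograph v" "dist (x, \<alpha>) (y, s) < \<alpha>"
    using H_end_lessD[OF assms(1-3)] by (metis surj_pair)
  have "dist x y < \<alpha>" "dist \<alpha> s < \<alpha>"
    using ys(2) dist_fst_le[of "(x, \<alpha>)" "(y, s)"] dist_snd_le[of "(x, \<alpha>)" "(y, s)"] by auto
  then have "0 < v y" using ys(1) by (auto simp: endograph_def dist_real_def)
  then have "y \<in> alpha_cut v 0"
    using closure_subset[of "{x. v x > 0}"] by (auto simp: alpha_cut_def)
  with \<open>dist x y < \<alpha>\<close> show ?thesis by blast
qed

text \<open>The net \<open>P\<close> determines an endograph up to \<open>2\<epsilon>\<close>: points above height \<open>\<epsilon>\<close> are transferred from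
  \<open>u\<close> to \<open>v\<close> through a net point, lower points through the base.\<close>

lemma endograph_near_of_same_net_points:
  assumes "range v \<subseteq> {0..1}" "0 < \<epsilon>"
    and cut: "{x. u x \<ge> \<epsilon>} \<subseteq> B" and net: "B \<times> {0..1} \<subseteq> (\<Union>p\<in>P. ball p \<epsilon>)"
    and same: "\<And>p. p \<in> P \<Longrightarrow> \<exists>q\<in>endograph u. dist p q < \<epsilon> \<Longrightarrow> \<exists>q\<in>endograph v. dist p q < \<epsilon>"
    and a: "a \<in> endograph u"
  shows "\<exists>b\<in>endograph v. dist a b \<le> 2 * \<epsilon>"
proof (cases "snd a \<ge> \<epsilon>")
  case True
  then have "a \<in> B \<times> {0..1}" using a cut by (auto simp: endograph_def)
  then obtain p where p: "p \<in> P" "dist p a < \<epsilon>" using net by auto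
  then obtain b where b: "b \<in> endograph v" "dist p b < \<epsilon>" using same a by blast
  have "dist a b \<le> 2 * \<epsilon>"
    using p(2) b(2) dist_triangle[of a b p] by (simp add: dist_commute)
  with b(1) show ?thesis by blast
next
  case False
  have "(fst a, 0) \<in> endograph v" by (rule endograph_base[OF assms(1)])
  moreover have "dist a (fst a, 0) \<le> 2 * \<epsilon>"
    using a False \<open>0 < \<epsilon>\<close> by (auto simp: endograph_def dist_Pair_Pair dist_real_def)
  ultimately show ?thesis by blast
qed

lemma mtotally_bounded_H_end_iff:
  fixes X U :: "(real ^ 'm \<Rightarrow> real) set"
  assumes X: "X \<subseteq> usc_fuzzy_sets" and "U \<subseteq> X"
  shows "Metric_space.mtotally_bounded X H_end U \<longleftrightarrow>
    (\<forall>\<alpha>\<in>{0<..1}. bounded (\<Union>u\<in>U. alpha_cut u \<alpha>))"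
proof -
  interpret Metric_space X H_end by (rule Metric_space_H_end[OF X])
  have rg: "range u \<subseteq> {0..1}" if "u \<in> U" for u
    using that assms usc_fuzzy_sets_range by blast
  show ?thesis
  proof (intro iffI ballI)
    fix \<alpha> :: real assume tb: "mtotally_bounded U" and \<alpha>: "\<alpha> \<in> {0<..1}"
    then have "0 < \<alpha>" by simp
    then obtain K where K: "finite K" "K \<subseteq> U" "U \<subseteq> (\<Union>v\<in>K. mball v \<alpha>)"
      using tb unfolding mtotally_bounded_def by meson
    have "bounded (\<Union>v\<in>K. alpha_cut v 0)"
      using K X assms(2) by (intro bounded_UN) (auto simp: usc_fuzzy_sets_def)
    then obtain r where r: "\<And>y. y \<in> (\<Union>v\<in>K. alpha_cut v 0) \<Longrightarrow> norm y \<le> r"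
      unfolding bounded_iff by blast
    have "norm x \<le> r + \<alpha>" if u: "u \<in> U" and x: "x \<in> alpha_cut u \<alpha>" for u x
    proof -
      obtain v where v: "v \<in> K" "H_end u v < \<alpha>" using K(3) u commute by fastforce
      then obtain y where y: "y \<in> alpha_cut v 0" "dist x y < \<alpha>"
        using alpha_cut_near_support[of u v \<alpha> x] rg u x K(2) \<alpha> by blast
      then have "norm y \<le> r" using r v(1) by blast
      then show ?thesis
        using y(2) norm_triangle_sub[of x y] by (simp add: dist_norm)
    qed
    then show "bounded (\<Union>u\<in>U. alpha_cut u \<alpha>)" unfolding bounded_iff by blast
  next
    assume bdd: "\<forall>\<alpha>\<in>{0<..1}. bounded (\<Union>u\<in>U. alpha_cut u \<alpha>)"
    show "mtotally_bounded U"
      unfolding mtotally_bounded_def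
    proof (intro allI impI)
      fix e :: real assume "0 < e"
      \<comment> \<open>Shared net points leave an error of \<open>2 * \<epsilon>\<close>, which is to be below \<open>e\<close>, and \<open>\<epsilon>\<close> is to be a
        level.\<close>
      define \<epsilon> where "\<epsilon> = min 1 (e / 3)"
      have \<epsilon>: "\<epsilon> \<in> {0<..1}" "2 * \<epsilon> < e" using \<open>0 < e\<close> by (auto simp: \<epsilon>_def min_def)
      define B where "B = closure (\<Union>u\<in>U. alpha_cut u \<epsilon>)"
      have "compact (B \<times> {0..1::real})"
        using bdd \<epsilon>(1) by (auto simp: B_def compact_closure intro!: compact_Times)
      then have "\<exists>P. finite P \<and> B \<times> {0..1::real} \<subseteq> (\<Union>p\<in>P. ball p \<epsilon>)"
        using \<epsilon>(1) unfolding compact_eq_totally_bounded by simp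
      then obtain P :: "((real ^ 'm) \<times> real) set"
        where "finite P \<and> B \<times> {0..1} \<subseteq> (\<Union>p\<in>P. ball p \<epsilon>)" ..
      then have P: "finite P" "B \<times> {0..1} \<subseteq> (\<Union>p\<in>P. ball p \<epsilon>)" by simp_all
      have cut: "{x. u x \<ge> \<epsilon>} \<subseteq> B" if "u \<in> U" for u
      proof -
        have "{x. u x \<ge> \<epsilon>} = alpha_cut u \<epsilon>" using \<epsilon>(1) by (simp add: alpha_cut_def)
        then show ?thesis
          using that closure_subset[of "\<Union>u\<in>U. alpha_cut u \<epsilon>"] by (auto simp: B_def)
      qed
      define near where "near u = {p \<in> P. \<exists>q\<in>endograph u. dist p q < \<epsilon>}" for u
      have close: "H_end u v < e" if uv: "u \<in> U" "v \<in> U" and eq: "near u = near v" for u v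
      proof -
        have same: "(\<exists>q\<in>endograph u. dist p q < \<epsilon>) \<longleftrightarrow> (\<exists>q\<in>endograph v. dist p q < \<epsilon>)"
          if "p \<in> P" for p
          using eq that unfolding near_def by blast
        have "H_end u v \<le> 2 * \<epsilon>"
        proof (rule H_end_leI)
          show "\<exists>q\<in>endograph v. dist p q \<le> 2 * \<epsilon>" if "p \<in> endograph u" for p
            using endograph_near_of_same_net_points[OF rg[OF uv(2)] _ cut[OF uv(1)] P(2) _ that]
              same \<epsilon>(1) by simp
          show "\<exists>q\<in>endograph u. dist p q \<le> 2 * \<epsilon>" if "p \<in> endograph v" for p
            using endograph_near_of_same_net_points[OF rg[OF uv(1)] _ cut[OF uv(2)] P(2) _ that]
              same \<epsilon>(1) by simp
        qed (use \<epsilon>(1) in simp)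
        with \<epsilon>(2) show ?thesis by simp
      qed
      have "finite (near ` U)"
        by (rule finite_subset[of _ "Pow P"]) (use P(1) in \<open>auto simp: near_def\<close>)
      then obtain K where K: "K \<subseteq> U" "finite K" "near ` U = near ` K"
        using finite_subset_image[of "near ` U" near U] by blast
      have "U \<subseteq> (\<Union>v\<in>K. mball v e)"
      proof
        fix u assume u: "u \<in> U"
        then have "near u \<in> near ` K" using K(3) by blast
        then obtain v where v: "v \<in> K" "near v = near u" by auto
        then have "u \<in> mball v e" using close[of v u] u K(1) assms(2) by auto
        with v(1) show "u \<in> (\<Union>v\<in>K. mball v e)" by blast
      qed
      with K show "\<exists>K. finite K \<and> K \<subseteq> U \<and> U \<subseteq> (\<Union>v\<in>K. mball v e)" by blast
    qed
  qed
qed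

theorem theorem9p18:
  fixes X U :: "(real ^ 'm \<Rightarrow> real) set" and \<K> :: "(real ^ 'm) set set"
  assumes "(X, \<K>) \<in> {(fuzzy_S_tilde, compact_starlike_sets),
                      (fuzzy_S, compact_starlike_sets),
                      (fuzzy_E, compact_convex_sets)}"
    and "U \<subseteq> X"
  shows "Metric_space.mtotally_bounded X H_end U \<longleftrightarrow>
    (\<forall>\<alpha>\<in>{0<..1}. Metric_space.mbounded \<K> hausdist ((\<lambda>u. alpha_cut u \<alpha>) ` U))"
proof -
  have X: "X \<subseteq> usc_fuzzy_sets"
    using assms(1) by (auto simp: fuzzy_S_tilde_def fuzzy_S_def fuzzy_E_def)
  have \<K>: "A \<noteq> {} \<and> compact A" if "A \<in> \<K>" for A
    using assms(1) that by (auto simp: compact_starlike_sets_def compact_convex_sets_def)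
  have "Metric_space.mbounded \<K> hausdist ((\<lambda>u. alpha_cut u \<alpha>) ` U) \<longleftrightarrow>
      bounded (\<Union>u\<in>U. alpha_cut u \<alpha>)" if \<alpha>: "\<alpha> \<in> {0<..1}" for \<alpha>
  proof (rule mbounded_hausdist_iff[OF \<K>])
    show "(\<lambda>u. alpha_cut u \<alpha>) ` U \<subseteq> \<K>"
      using alpha_cut_in_shape_class[OF assms(1) _ \<alpha>] assms(2) by blast
  qed
  then show ?thesis
    using mtotally_bounded_H_end_iff[OF X assms(2)] by simp
qed

end
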